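(* Let $M\mapsto M^*$ be the translation from the untyped effect handler calculus to the untyped delimited control calculus that is homomorphic on all core constructs and satisfies $(\mathit{op}\,V)^*=\mathcal{S}_0k.\lambda h.\,h!\,(\mathit{op}\,(V^*,\{\lambda y.\,k!\,y\,h\}))$ (using the operation name $\mathit{op}$ as a variant label) and, for a handler $H=\{\mathtt{return}\,x\mapsto N_{\mathrm{ret}}\}\uplus\{\mathit{op}_i\,p_i\,k_i\mapsto N_i\}_{i=1}^n$, $(\mathtt{handle}\,M\,\mathtt{with}\,H)^*=\langle M^*\mid x.\lambda h.N_{\mathrm{ret}}^*\rangle\,\{H^{\mathrm{ops}}\}$ where $H^{\mathrm{ops}}=\lambda y.\,\mathtt{case}\,y\,\mathtt{of}\,\{\mathit{op}_i\,(p_i,k_i)\mapsto N_i^*\}_{i=1}^n$ (with $h,k,y$ fresh and nested patterns desugared to $\mathtt{let}\,(p_i,k_i)=\cdot\,\mathtt{in}$). Then for all computations $M,N$ of the effect handler calculus, $M\to N$ implies $M^*\rightsquigarrow^{+}N^*$.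
   Context: Core syntax (shared). Values $V ::= x \mid () \mid (V_1,V_2) \mid \ell\,V \mid \{M\}$; computations $M,N ::= \mathtt{let}\,(x,y)=V\,\mathtt{in}\,M \mid \mathtt{case}\,V\,\mathtt{of}\,\{\ell_i x_i\mapsto M_i\}_i \mid V! \mid \mathtt{return}\,V \mid \mathtt{let}\,x\Leftarrow M\,\mathtt{in}\,N \mid \lambda x.M \mid M\,V \mid \langle M_1,M_2\rangle \mid \mathrm{prj}_i M$. Core $\beta$-rules: $\mathtt{let}\,(x,y)=(V_1,V_2)\,\mathtt{in}\,M \to_\beta M[V_1/x,V_2/y]$; $\mathtt{case}\,\ell_j V\,\mathtt{of}\,\{\dots\ell_j x_j\mapsto M_j\dots\}\to_\beta M_j[V/x_j]$; $\{M\}!\to_\beta M$; $\mathtt{let}\,x\Leftarrow\mathtt{return}\,V\,\mathtt{in}\,N\to_\beta N[V/x]$; $(\lambda x.M)V\to_\beta M[V/x]$; $\mathrm{prj}_i\langle M_1,M_2\rangle\to_\beta M_i$. Basic frames $B ::= \mathtt{let}\,x\Leftarrow[\,]\,\mathtt{in}\,N\mid[\,]\,V\mid\mathrm{prj}_i[\,]$; hoisting contexts $\mathcal{H}::=[\,]\mid\mathcal{H}[B]$. In each calculus $M\to N$ iff $M=K[M']$, $N=K[N']$ with $M'\to_\beta N'$ and $K$ an evaluation context of that calculus. Effect handler calculus: operation names $\mathit{op}$; adds computations $\mathit{op}\,V$ and $\mathtt{handle}\,M\,\mathtt{with}\,H$, where $H$ has a return clause $\mathtt{return}\,x\mapsto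 N_{\mathrm{ret}}$ and operation clauses $\mathit{op}\,p\,k\mapsto N_{\mathit{op}}$ for $\mathit{op}$ in a finite set $\mathrm{ops}(H)$; evaluation contexts $K::=[\,]\mid K[B]\mid K[\mathtt{handle}\,[\,]\,\mathtt{with}\,H]$; extra rules $\mathtt{handle}\,(\mathtt{return}\,V)\,\mathtt{with}\,H\to_\beta N_{\mathrm{ret}}[V/x]$ and $\mathtt{handle}\,\mathcal{H}[\mathit{op}\,V]\,\mathtt{with}\,H\to_\beta N_{\mathit{op}}[V/p,\{\lambda y.\mathtt{handle}\,\mathcal{H}[\mathtt{return}\,y]\,\mathtt{with}\,H\}/k]$ for $\mathit{op}\in\mathrm{ops}(H)$. Delimited control calculus: adds computations $\mathcal{S}_0k.M$ and $\langle M\mid x.N\rangle$; evaluation contexts $K::=[\,]\mid K[B]\mid K[\langle[\,]\mid x.N\rangle]$; extra rules $\langle\mathtt{return}\,V\mid x.N\rangle\to_\beta N[V/x]$ and $\langle\mathcal{H}[\mathcal{S}_0k.M]\mid x.N\rangle\to_\beta M[\{\lambda y.\langle\mathcal{H}[\mathtt{return}\,y]\mid x.N\rangle\}/k]$. $\rightsquigarrow$ is the smallest relation on target terms containing $\to_\beta$ and closed under all term-forming constructs; $\rightsquigarrow^{+}$ is its transitive closure. *)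

theory Defs
  imports "HOL-Library.Finite_Map"
begin

text \<open>
  Terms are identified up to renaming of bound variables and therefore use de Bruijn indices:
  a binder for one variable makes it index \<open>0\<close>, a binder for two variables \<open>(x, y)\<close> or \<open>(p, k)\<close>
  makes the second one index \<open>0\<close> and the first one index \<open>1\<close>. Families of clauses are finite maps
  from labels (or operation names) to clause bodies. The type \<open>'l\<close> contains both the variant
  labels and the operation names, so that an operation name can be used as a variant label.
\<close>

section \<open>Effect handler calculus\<close>

text \<open>
  In \<open>EHandle M N H\<close>, \<open>N\<close> is the body of the return clause (binding \<open>x\<close>) and \<open>H\<close> the operation
  clauses (each binding \<open>p\<close> and \<open>k\<close>); the set \<open>ops(H)\<close> is the domain of \<open>H\<close>.
\<close>

datatype 'l evalue =
    EVar nat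
  | EUnit
  | EPair "'l evalue" "'l evalue"
  | EInj 'l "'l evalue"
  | EThunk "'l ecomp"
and 'l ecomp =
    ELetPair "'l evalue" "'l ecomp"
  | ECase "'l evalue" "('l, 'l ecomp) fmap"
  | EForce "'l evalue"
  | EReturn "'l evalue"
  | ELet "'l ecomp" "'l ecomp"
  | ELam "'l ecomp"
  | EApp "'l ecomp" "'l evalue"
  | ECPair "'l ecomp" "'l ecomp"
  | EPrj1 "'l ecomp"
  | EPrj2 "'l ecomp"
  | EOp 'l "'l evalue"
  | EHandle "'l ecomp" "'l ecomp" "('l, 'l ecomp) fmap"

definition up_ren :: "(nat \<Rightarrow> nat) \<Rightarrow> nat \<Rightarrow> nat" where
  "up_ren r = case_nat 0 (\<lambda>n. Suc (r n))"

primrec eren_val :: "(nat \<Rightarrow> nat) \<Rightarrow> 'l evalue \<Rightarrow> 'l evalue"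
  and eren :: "(nat \<Rightarrow> nat) \<Rightarrow> 'l ecomp \<Rightarrow> 'l ecomp" where
  "eren_val r (EVar n) = EVar (r n)"
| "eren_val r EUnit = EUnit"
| "eren_val r (EPair V W) = EPair (eren_val r V) (eren_val r W)"
| "eren_val r (EInj l V) = EInj l (eren_val r V)"
| "eren_val r (EThunk M) = EThunk (eren r M)"
| "eren r (ELetPair V M) = ELetPair (eren_val r V) (eren (up_ren (up_ren r)) M)"
| "eren r (ECase V C) = ECase (eren_val r V) (fmmap (\<lambda>M. eren (up_ren r) M) C)"
| "eren r (EForce V) = EForce (eren_val r V)"
| "eren r (EReturn V) = EReturn (eren_val r V)"
| "eren r (ELet M N) = ELet (eren r M) (eren (up_ren r) N)"
| "eren r (ELam M) = ELam (eren (up_ren r) M)"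
| "eren r (EApp M V) = EApp (eren r M) (eren_val r V)"
| "eren r (ECPair M N) = ECPair (eren r M) (eren r N)"
| "eren r (EPrj1 M) = EPrj1 (eren r M)"
| "eren r (EPrj2 M) = EPrj2 (eren r M)"
| "eren r (EOp l V) = EOp l (eren_val r V)"
| "eren r (EHandle M N H) =
     EHandle (eren r M) (eren (up_ren r) N) (fmmap (\<lambda>M'. eren (up_ren (up_ren r)) M') H)"

definition eup :: "(nat \<Rightarrow> 'l evalue) \<Rightarrow> nat \<Rightarrow> 'l evalue" where
  "eup s = case_nat (EVar 0) (\<lambda>n. eren_val Suc (s n))"

primrec esub_val :: "(nat \<Rightarrow> 'l evalue) \<Rightarrow> 'l evalue \<Rightarrow> 'l evalue"
  and esub :: "(nat \<Rightarrow> 'l evalue) \<Rightarrow> 'l ecomp \<Rightarrow> 'l ecomp" where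
  "esub_val s (EVar n) = s n"
| "esub_val s EUnit = EUnit"
| "esub_val s (EPair V W) = EPair (esub_val s V) (esub_val s W)"
| "esub_val s (EInj l V) = EInj l (esub_val s V)"
| "esub_val s (EThunk M) = EThunk (esub s M)"
| "esub s (ELetPair V M) = ELetPair (esub_val s V) (esub (eup (eup s)) M)"
| "esub s (ECase V C) = ECase (esub_val s V) (fmmap (\<lambda>M. esub (eup s) M) C)"
| "esub s (EForce V) = EForce (esub_val s V)"
| "esub s (EReturn V) = EReturn (esub_val s V)"
| "esub s (ELet M N) = ELet (esub s M) (esub (eup s) N)"
| "esub s (ELam M) = ELam (esub (eup s) M)"
| "esub s (EApp M V) = EApp (esub s M) (esub_val s V)"
| "esub s (ECPair M N) = ECPair (esub s M) (esub s N)"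
| "esub s (EPrj1 M) = EPrj1 (esub s M)"
| "esub s (EPrj2 M) = EPrj2 (esub s M)"
| "esub s (EOp l V) = EOp l (esub_val s V)"
| "esub s (EHandle M N H) =
     EHandle (esub s M) (esub (eup s) N) (fmmap (\<lambda>M'. esub (eup (eup s)) M') H)"

definition esub1 :: "'l ecomp \<Rightarrow> 'l evalue \<Rightarrow> 'l ecomp" where
  "esub1 M V = esub (case_nat V EVar) M"

text \<open>\<open>esub2 M V W\<close> replaces the outer variable (index \<open>1\<close>) by \<open>V\<close> and the inner one by \<open>W\<close>.\<close>

definition esub2 :: "'l ecomp \<Rightarrow> 'l evalue \<Rightarrow> 'l evalue \<Rightarrow> 'l ecomp" where
  "esub2 M V W = esub (case_nat W (case_nat V EVar)) M"

datatype 'l eframe =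
    EFLet "'l ecomp"
  | EFApp "'l evalue"
  | EFPrj1
  | EFPrj2

primrec eplug_frame :: "'l eframe \<Rightarrow> 'l ecomp \<Rightarrow> 'l ecomp" where
  "eplug_frame (EFLet N) M = ELet M N"
| "eplug_frame (EFApp V) M = EApp M V"
| "eplug_frame EFPrj1 M = EPrj1 M"
| "eplug_frame EFPrj2 M = EPrj2 M"

primrec eren_frame :: "(nat \<Rightarrow> nat) \<Rightarrow> 'l eframe \<Rightarrow> 'l eframe" where
  "eren_frame r (EFLet N) = EFLet (eren (up_ren r) N)"
| "eren_frame r (EFApp V) = EFApp (eren_val r V)"
| "eren_frame r EFPrj1 = EFPrj1"
| "eren_frame r EFPrj2 = EFPrj2"

datatype 'l ehoist = EHHole | EHFrame "'l ehoist" "'l eframe"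

primrec eplug_hoist :: "'l ehoist \<Rightarrow> 'l ecomp \<Rightarrow> 'l ecomp" where
  "eplug_hoist EHHole M = M"
| "eplug_hoist (EHFrame C B) M = eplug_hoist C (eplug_frame B M)"

primrec eren_hoist :: "(nat \<Rightarrow> nat) \<Rightarrow> 'l ehoist \<Rightarrow> 'l ehoist" where
  "eren_hoist r EHHole = EHHole"
| "eren_hoist r (EHFrame C B) = EHFrame (eren_hoist r C) (eren_frame r B)"

datatype 'l ectx =
    EKHole
  | EKFrame "'l ectx" "'l eframe"
  | EKHandle "'l ectx" "'l ecomp" "('l, 'l ecomp) fmap"

primrec eplug :: "'l ectx \<Rightarrow> 'l ecomp \<Rightarrow> 'l ecomp" where
  "eplug EKHole M = M"
| "eplug (EKFrame K B) M = eplug K (eplug_frame B M)"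
| "eplug (EKHandle K N H) M = eplug K (EHandle M N H)"

text \<open>In the last rule the hoisting context and the handler move under the binder \<open>\<lambda>y\<close>.\<close>

inductive ebeta :: "'l ecomp \<Rightarrow> 'l ecomp \<Rightarrow> bool" where
  "ebeta (ELetPair (EPair V W) M) (esub2 M V W)"
| "fmlookup C l = Some M \<Longrightarrow> ebeta (ECase (EInj l V) C) (esub1 M V)"
| "ebeta (EForce (EThunk M)) M"
| "ebeta (ELet (EReturn V) N) (esub1 N V)"
| "ebeta (EApp (ELam M) V) (esub1 M V)"
| "ebeta (EPrj1 (ECPair M N)) M"
| "ebeta (EPrj2 (ECPair M N)) N"
| "ebeta (EHandle (EReturn V) N H) (esub1 N V)"
| "fmlookup H l = Some M \<Longrightarrow>
   ebeta (EHandle (eplug_hoist C (EOp l V)) N H)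
     (esub2 M V (EThunk (ELam
       (EHandle (eplug_hoist (eren_hoist Suc C) (EReturn (EVar 0)))
          (eren (up_ren Suc) N) (fmmap (eren (up_ren (up_ren Suc))) H)))))"

definition estep :: "'l ecomp \<Rightarrow> 'l ecomp \<Rightarrow> bool" where
  "estep M N \<longleftrightarrow> (\<exists>K M' N'. M = eplug K M' \<and> N = eplug K N' \<and> ebeta M' N')"


section \<open>Delimited control calculus\<close>

text \<open>\<open>DShift0 M\<close> is \<open>S\<^sub>0 k. M\<close> and \<open>DReset M N\<close> is \<open>\<langle>M | x. N\<rangle>\<close>.\<close>

datatype 'l dvalue =
    DVar nat
  | DUnit
  | DPair "'l dvalue" "'l dvalue"
  | DInj 'l "'l dvalue"
  | DThunk "'l dcomp"
and 'l dcomp =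
    DLetPair "'l dvalue" "'l dcomp"
  | DCase "'l dvalue" "('l, 'l dcomp) fmap"
  | DForce "'l dvalue"
  | DReturn "'l dvalue"
  | DLet "'l dcomp" "'l dcomp"
  | DLam "'l dcomp"
  | DApp "'l dcomp" "'l dvalue"
  | DCPair "'l dcomp" "'l dcomp"
  | DPrj1 "'l dcomp"
  | DPrj2 "'l dcomp"
  | DShift0 "'l dcomp"
  | DReset "'l dcomp" "'l dcomp"

primrec dren_val :: "(nat \<Rightarrow> nat) \<Rightarrow> 'l dvalue \<Rightarrow> 'l dvalue"
  and dren :: "(nat \<Rightarrow> nat) \<Rightarrow> 'l dcomp \<Rightarrow> 'l dcomp" where
  "dren_val r (DVar n) = DVar (r n)"
| "dren_val r DUnit = DUnit"
| "dren_val r (DPair V W) = DPair (dren_val r V) (dren_val r W)"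
| "dren_val r (DInj l V) = DInj l (dren_val r V)"
| "dren_val r (DThunk M) = DThunk (dren r M)"
| "dren r (DLetPair V M) = DLetPair (dren_val r V) (dren (up_ren (up_ren r)) M)"
| "dren r (DCase V C) = DCase (dren_val r V) (fmmap (\<lambda>M. dren (up_ren r) M) C)"
| "dren r (DForce V) = DForce (dren_val r V)"
| "dren r (DReturn V) = DReturn (dren_val r V)"
| "dren r (DLet M N) = DLet (dren r M) (dren (up_ren r) N)"
| "dren r (DLam M) = DLam (dren (up_ren r) M)"
| "dren r (DApp M V) = DApp (dren r M) (dren_val r V)"
| "dren r (DCPair M N) = DCPair (dren r M) (dren r N)"
| "dren r (DPrj1 M) = DPrj1 (dren r M)"
| "dren r (DPrj2 M) = DPrj2 (dren r M)"
| "dren r (DShift0 M) = DShift0 (dren (up_ren r) M)"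
| "dren r (DReset M N) = DReset (dren r M) (dren (up_ren r) N)"

definition dup :: "(nat \<Rightarrow> 'l dvalue) \<Rightarrow> nat \<Rightarrow> 'l dvalue" where
  "dup s = case_nat (DVar 0) (\<lambda>n. dren_val Suc (s n))"

primrec dsub_val :: "(nat \<Rightarrow> 'l dvalue) \<Rightarrow> 'l dvalue \<Rightarrow> 'l dvalue"
  and dsub :: "(nat \<Rightarrow> 'l dvalue) \<Rightarrow> 'l dcomp \<Rightarrow> 'l dcomp" where
  "dsub_val s (DVar n) = s n"
| "dsub_val s DUnit = DUnit"
| "dsub_val s (DPair V W) = DPair (dsub_val s V) (dsub_val s W)"
| "dsub_val s (DInj l V) = DInj l (dsub_val s V)"
| "dsub_val s (DThunk M) = DThunk (dsub s M)"
| "dsub s (DLetPair V M) = DLetPair (dsub_val s V) (dsub (dup (dup s)) M)"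
| "dsub s (DCase V C) = DCase (dsub_val s V) (fmmap (\<lambda>M. dsub (dup s) M) C)"
| "dsub s (DForce V) = DForce (dsub_val s V)"
| "dsub s (DReturn V) = DReturn (dsub_val s V)"
| "dsub s (DLet M N) = DLet (dsub s M) (dsub (dup s) N)"
| "dsub s (DLam M) = DLam (dsub (dup s) M)"
| "dsub s (DApp M V) = DApp (dsub s M) (dsub_val s V)"
| "dsub s (DCPair M N) = DCPair (dsub s M) (dsub s N)"
| "dsub s (DPrj1 M) = DPrj1 (dsub s M)"
| "dsub s (DPrj2 M) = DPrj2 (dsub s M)"
| "dsub s (DShift0 M) = DShift0 (dsub (dup s) M)"
| "dsub s (DReset M N) = DReset (dsub s M) (dsub (dup s) N)"

definition dsub1 :: "'l dcomp \<Rightarrow> 'l dvalue \<Rightarrow> 'l dcomp" where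
  "dsub1 M V = dsub (case_nat V DVar) M"

definition dsub2 :: "'l dcomp \<Rightarrow> 'l dvalue \<Rightarrow> 'l dvalue \<Rightarrow> 'l dcomp" where
  "dsub2 M V W = dsub (case_nat W (case_nat V DVar)) M"

datatype 'l dframe =
    DFLet "'l dcomp"
  | DFApp "'l dvalue"
  | DFPrj1
  | DFPrj2

primrec dplug_frame :: "'l dframe \<Rightarrow> 'l dcomp \<Rightarrow> 'l dcomp" where
  "dplug_frame (DFLet N) M = DLet M N"
| "dplug_frame (DFApp V) M = DApp M V"
| "dplug_frame DFPrj1 M = DPrj1 M"
| "dplug_frame DFPrj2 M = DPrj2 M"

primrec dren_frame :: "(nat \<Rightarrow> nat) \<Rightarrow> 'l dframe \<Rightarrow> 'l dframe" where
  "dren_frame r (DFLet N) = DFLet (dren (up_ren r) N)"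
| "dren_frame r (DFApp V) = DFApp (dren_val r V)"
| "dren_frame r DFPrj1 = DFPrj1"
| "dren_frame r DFPrj2 = DFPrj2"

datatype 'l dhoist = DHHole | DHFrame "'l dhoist" "'l dframe"

primrec dplug_hoist :: "'l dhoist \<Rightarrow> 'l dcomp \<Rightarrow> 'l dcomp" where
  "dplug_hoist DHHole M = M"
| "dplug_hoist (DHFrame C B) M = dplug_hoist C (dplug_frame B M)"

primrec dren_hoist :: "(nat \<Rightarrow> nat) \<Rightarrow> 'l dhoist \<Rightarrow> 'l dhoist" where
  "dren_hoist r DHHole = DHHole"
| "dren_hoist r (DHFrame C B) = DHFrame (dren_hoist r C) (dren_frame r B)"

inductive dbeta :: "'l dcomp \<Rightarrow> 'l dcomp \<Rightarrow> bool" where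
  "dbeta (DLetPair (DPair V W) M) (dsub2 M V W)"
| "fmlookup C l = Some M \<Longrightarrow> dbeta (DCase (DInj l V) C) (dsub1 M V)"
| "dbeta (DForce (DThunk M)) M"
| "dbeta (DLet (DReturn V) N) (dsub1 N V)"
| "dbeta (DApp (DLam M) V) (dsub1 M V)"
| "dbeta (DPrj1 (DCPair M N)) M"
| "dbeta (DPrj2 (DCPair M N)) N"
| "dbeta (DReset (DReturn V) N) (dsub1 N V)"
| "dbeta (DReset (dplug_hoist C (DShift0 M)) N)
     (dsub1 M (DThunk (DLam
       (DReset (dplug_hoist (dren_hoist Suc C) (DReturn (DVar 0))) (dren (up_ren Suc) N)))))"

text \<open>
  The compatible closure of \<open>dbeta\<close>: one \<open>\<beta>\<close>-step at an arbitrary position, also under binders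
  and inside values.
\<close>

inductive dred_val :: "'l dvalue \<Rightarrow> 'l dvalue \<Rightarrow> bool"
  and dred :: "'l dcomp \<Rightarrow> 'l dcomp \<Rightarrow> bool" where
  "dbeta M N \<Longrightarrow> dred M N"
| "dred_val V V' \<Longrightarrow> dred_val (DPair V W) (DPair V' W)"
| "dred_val W W' \<Longrightarrow> dred_val (DPair V W) (DPair V W')"
| "dred_val V V' \<Longrightarrow> dred_val (DInj l V) (DInj l V')"
| "dred M M' \<Longrightarrow> dred_val (DThunk M) (DThunk M')"
| "dred_val V V' \<Longrightarrow> dred (DLetPair V M) (DLetPair V' M)"
| "dred M M' \<Longrightarrow> dred (DLetPair V M) (DLetPair V M')"
| "dred_val V V' \<Longrightarrow> dred (DCase V C) (DCase V' C)"
| "fmlookup C l = Some M \<Longrightarrow> dred M M' \<Longrightarrow> dred (DCase V C) (DCase V (fmupd l M' C))"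
| "dred_val V V' \<Longrightarrow> dred (DForce V) (DForce V')"
| "dred_val V V' \<Longrightarrow> dred (DReturn V) (DReturn V')"
| "dred M M' \<Longrightarrow> dred (DLet M N) (DLet M' N)"
| "dred N N' \<Longrightarrow> dred (DLet M N) (DLet M N')"
| "dred M M' \<Longrightarrow> dred (DLam M) (DLam M')"
| "dred M M' \<Longrightarrow> dred (DApp M V) (DApp M' V)"
| "dred_val V V' \<Longrightarrow> dred (DApp M V) (DApp M V')"
| "dred M M' \<Longrightarrow> dred (DCPair M N) (DCPair M' N)"
| "dred N N' \<Longrightarrow> dred (DCPair M N) (DCPair M N')"
| "dred M M' \<Longrightarrow> dred (DPrj1 M) (DPrj1 M')"
| "dred M M' \<Longrightarrow> dred (DPrj2 M) (DPrj2 M')"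
| "dred M M' \<Longrightarrow> dred (DShift0 M) (DShift0 M')"
| "dred M M' \<Longrightarrow> dred (DReset M N) (DReset M' N)"
| "dred N N' \<Longrightarrow> dred (DReset M N) (DReset M N')"


section \<open>The translation\<close>

text \<open>
  \<open>op_clauses H\<close> is \<open>\<lambda>y. case y of {op\<^sub>i z \<mapsto> let (p\<^sub>i, k\<^sub>i) = z in N\<^sub>i}\<close> for the translated clause
  bodies \<open>N\<^sub>i\<close> in \<open>H\<close>; the renaming skips the binders \<open>y\<close> and \<open>z\<close>, which enclose those of \<open>p\<^sub>i\<close>
  and \<open>k\<^sub>i\<close>.
\<close>

definition op_clauses :: "('l, 'l dcomp) fmap \<Rightarrow> 'l dcomp" where
  "op_clauses H =
     DLam (DCase (DVar 0)
       (fmmap (\<lambda>N. DLetPair (DVar 0) (dren (up_ren (up_ren (\<lambda>n. n + 2))) N)) H))"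

text \<open>
  In the clause for \<open>EOp\<close>, the innermost body \<open>k! y h\<close> has \<open>y\<close>, \<open>h\<close>, \<open>k\<close> at indices \<open>0\<close>, \<open>1\<close>, \<open>2\<close>.
\<close>

primrec trans_val :: "'l evalue \<Rightarrow> 'l dvalue"
  and trans_comp :: "'l ecomp \<Rightarrow> 'l dcomp" where
  "trans_val (EVar n) = DVar n"
| "trans_val EUnit = DUnit"
| "trans_val (EPair V W) = DPair (trans_val V) (trans_val W)"
| "trans_val (EInj l V) = DInj l (trans_val V)"
| "trans_val (EThunk M) = DThunk (trans_comp M)"
| "trans_comp (ELetPair V M) = DLetPair (trans_val V) (trans_comp M)"
| "trans_comp (ECase V C) = DCase (trans_val V) (fmmap trans_comp C)"
| "trans_comp (EForce V) = DForce (trans_val V)"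
| "trans_comp (EReturn V) = DReturn (trans_val V)"
| "trans_comp (ELet M N) = DLet (trans_comp M) (trans_comp N)"
| "trans_comp (ELam M) = DLam (trans_comp M)"
| "trans_comp (EApp M V) = DApp (trans_comp M) (trans_val V)"
| "trans_comp (ECPair M N) = DCPair (trans_comp M) (trans_comp N)"
| "trans_comp (EPrj1 M) = DPrj1 (trans_comp M)"
| "trans_comp (EPrj2 M) = DPrj2 (trans_comp M)"
| "trans_comp (EOp l V) =
     DShift0 (DLam (DApp (DForce (DVar 0))
       (DInj l (DPair (dren_val (\<lambda>n. n + 2) (trans_val V))
         (DThunk (DLam (DApp (DApp (DForce (DVar 2)) (DVar 0)) (DVar 1))))))))"
| "trans_comp (EHandle M N H) =
     DApp (DReset (trans_comp M) (DLam (dren Suc (trans_comp N))))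
       (DThunk (op_clauses (fmmap trans_comp H)))"

end

theory Submission
  imports Defs
begin

text \<open>
  The translation commutes with renaming, substitution and hoisting contexts, so every core rule
  is simulated by one step and the return clause by two. An operation clause is simulated by
  capturing the hoisting context with \<open>S\<^sub>0\<close>, passing the clauses as \<open>h\<close>, and then dispatching on the
  operation label. The resumption \<open>{\<lambda>y. k! y h}\<close> obtained in this way still has to become the
  translation of the source resumption; the two steps for this are taken while it is an argument
  of the dispatch function, since the clause body may duplicate or discard it.
\<close>

section \<open>Renaming and substitution in the delimited control calculus\<close>

lemma up_ren_simps [simp]: "up_ren r 0 = 0" "up_ren r (Suc n) = Suc (r n)"
  by (simp_all add: up_ren_def)

lemma dup_simps [simp]: "dup s 0 = DVar 0" "dup s (Suc n) = dren_val Suc (s n)"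
  by (simp_all add: dup_def)

lemma up_ren_comp: "up_ren r \<circ> up_ren r' = up_ren (r \<circ> r')"
  by (auto simp: fun_eq_iff up_ren_def split: nat.split)

lemma dup_comp_up_ren: "dup s \<circ> up_ren r = dup (s \<circ> r)"
  by (auto simp: fun_eq_iff dup_def split: nat.split)

lemma dup_DVar_comp: "dup (DVar \<circ> r) = DVar \<circ> up_ren r"
  by (auto simp: fun_eq_iff dup_def up_ren_def split: nat.split)

lemma dren_dren:
  fixes V :: "'l dvalue" and M :: "'l dcomp"
  shows "dren_val r (dren_val r' V) = dren_val (r \<circ> r') V"
    and "dren r (dren r' M) = dren (r \<circ> r') M"
  by (induction V and M arbitrary: r r' and r r' rule: dvalue.induct dcomp.induct)
    (auto simp: up_ren_comp fmap.map_comp intro!: fmap.map_cong)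

lemma dsub_dren:
  fixes V :: "'l dvalue" and M :: "'l dcomp"
  shows "dsub_val s (dren_val r V) = dsub_val (s \<circ> r) V"
    and "dsub s (dren r M) = dsub (s \<circ> r) M"
  by (induction V and M arbitrary: s r and s r rule: dvalue.induct dcomp.induct)
    (auto simp: dup_comp_up_ren fmap.map_comp intro!: fmap.map_cong)

text \<open>Substitutions that only return variables act as renamings. This settles the cases where
  instantiating a binder merely cancels part of a shift.\<close>

lemma dsub_DVar_comp:
  fixes V :: "'l dvalue" and M :: "'l dcomp"
  shows "dsub_val (DVar \<circ> r) V = dren_val r V"
    and "dsub (DVar \<circ> r) M = dren r M"
  by (induction V and M arbitrary: r and r rule: dvalue.induct dcomp.induct)
    (auto simp: dup_DVar_comp intro!: fmap.map_cong)

text \<open>Away from the new variable, \<open>r\<close> has to be exchanged with the shift inside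
  \<open>dup\<close>, which is fusion of renamings.\<close>

lemma dren_val_comp_dup: "dren_val (up_ren r) \<circ> dup s = dup (dren_val r \<circ> s)"
  by (auto simp: fun_eq_iff dup_def dren_dren comp_def split: nat.split)

lemma dren_dsub:
  fixes V :: "'l dvalue" and M :: "'l dcomp"
  shows "dren_val r (dsub_val s V) = dsub_val (dren_val r \<circ> s) V"
    and "dren r (dsub s M) = dsub (dren_val r \<circ> s) M"
  by (induction V and M arbitrary: r s and r s rule: dvalue.induct dcomp.induct)
    (auto simp: dren_val_comp_dup fmap.map_comp intro!: fmap.map_cong)

lemma up_ren_id: "up_ren (\<lambda>n. n) = (\<lambda>n. n)"
  by (auto simp: fun_eq_iff up_ren_def split: nat.split)

lemma dren_id:
  fixes V :: "'l dvalue" and M :: "'l dcomp"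
  shows "dren_val (\<lambda>n. n) V = V" and "dren (\<lambda>n. n) M = M"
  by (induction V and M rule: dvalue.induct dcomp.induct)
    (auto simp: up_ren_id fmap.map_ident_strong)

lemma dsub_DVar:
  fixes V :: "'l dvalue" and M :: "'l dcomp"
  shows "dsub_val DVar V = V" and "dsub DVar M = M"
  using dsub_DVar_comp[of "\<lambda>n. n"] by (simp_all add: dren_id comp_def)

section \<open>Compatibility of the translation\<close>

lemma dren_op_clauses:
  "dren r (op_clauses H) = op_clauses (fmmap (dren (up_ren (up_ren r))) H)"
proof -
  \<comment> \<open>A clause body is shifted past \<open>y\<close> and \<open>z\<close>; beyond that
    shift the doubly lifted \<open>r\<close> acts as \<open>r\<close> itself.\<close>
  have "up_ren (up_ren r) \<circ> (\<lambda>n. n + 2) = (\<lambda>n. n + 2) \<circ> r"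
    by (simp add: fun_eq_iff)
  then show ?thesis
    by (auto simp: op_clauses_def fmap.map_comp dren_dren up_ren_comp intro!: fmap.map_cong)
qed

lemma dsub_op_clauses:
  "dsub s (op_clauses H) = op_clauses (fmmap (dsub (dup (dup s))) H)"
proof -
  have "dup (dup s) \<circ> (\<lambda>n. n + 2) = dren_val (\<lambda>n. n + 2) \<circ> s"
    by (simp add: fun_eq_iff dren_dren comp_def)
  then show ?thesis
    by (auto simp: op_clauses_def fmap.map_comp dsub_dren dren_dsub dup_comp_up_ren
        dren_val_comp_dup intro!: fmap.map_cong)
qed

lemma trans_ren:
  fixes V :: "'l evalue" and M :: "'l ecomp"
  shows "trans_val (eren_val r V) = dren_val r (trans_val V)"
    and "trans_comp (eren r M) = dren r (trans_comp M)"
  by (induction V and M arbitrary: r and r rule: evalue.induct ecomp.induct)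
    (auto simp: dren_op_clauses dren_dren fmap.map_comp comp_def numeral_2_eq_2
      intro!: arg_cong[where f = op_clauses] fmap.map_cong)

text \<open>Lifting a substitution shifts its values by a renaming, so compatibility with renaming
  comes before that with substitution.\<close>

lemma trans_val_eup: "trans_val (eup s n) = dup (\<lambda>n. trans_val (s n)) n"
  by (auto simp: eup_def dup_def trans_ren split: nat.split)

lemma trans_sub:
  fixes V :: "'l evalue" and M :: "'l ecomp"
  shows "trans_val (esub_val s V) = dsub_val (trans_val \<circ> s) (trans_val V)"
    and "trans_comp (esub s M) = dsub (trans_val \<circ> s) (trans_comp M)"
  by (induction V and M arbitrary: s and s rule: evalue.induct ecomp.induct)
    (auto simp: dsub_op_clauses dsub_dren dren_dsub dren_dren trans_val_eup fmap.map_comp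
      comp_def numeral_2_eq_2
      intro!: arg_cong[where f = op_clauses] fmap.map_cong)

lemma trans_sub1: "trans_comp (esub1 M V) = dsub1 (trans_comp M) (trans_val V)"
proof -
  have "trans_val \<circ> case_nat V EVar = case_nat (trans_val V) DVar"
    by (auto simp: fun_eq_iff split: nat.split)
  then show ?thesis
    by (simp add: esub1_def dsub1_def trans_sub)
qed

lemma trans_sub2:
  "trans_comp (esub2 M V W) = dsub2 (trans_comp M) (trans_val V) (trans_val W)"
proof -
  have "trans_val \<circ> case_nat W (case_nat V EVar)
      = case_nat (trans_val W) (case_nat (trans_val V) DVar)"
    by (auto simp: fun_eq_iff split: nat.split)
  then show ?thesis
    by (simp add: esub2_def dsub2_def trans_sub)
qed

text \<open>Basic frames are core constructs, on which the translation is homomorphic. Hence a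
  hoisting context becomes a hoisting context, and \<open>DShift0\<close> can capture it
  whole.\<close>

primrec trans_frame :: "'l eframe \<Rightarrow> 'l dframe" where
  "trans_frame (EFLet N) = DFLet (trans_comp N)"
| "trans_frame (EFApp V) = DFApp (trans_val V)"
| "trans_frame EFPrj1 = DFPrj1"
| "trans_frame EFPrj2 = DFPrj2"

primrec trans_hoist :: "'l ehoist \<Rightarrow> 'l dhoist" where
  "trans_hoist EHHole = DHHole"
| "trans_hoist (EHFrame C B) = DHFrame (trans_hoist C) (trans_frame B)"

lemma trans_plug_frame: "trans_comp (eplug_frame B M) = dplug_frame (trans_frame B) (trans_comp M)"
  by (cases B) simp_all

lemma trans_plug_hoist: "trans_comp (eplug_hoist C M) = dplug_hoist (trans_hoist C) (trans_comp M)"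
  by (induction C arbitrary: M) (simp_all add: trans_plug_frame)

lemma trans_ren_frame: "trans_frame (eren_frame r B) = dren_frame r (trans_frame B)"
  by (cases B) (simp_all add: trans_ren)

lemma trans_ren_hoist: "trans_hoist (eren_hoist r C) = dren_hoist r (trans_hoist C)"
  by (induction C) (simp_all add: trans_ren_frame)

section \<open>Simulation\<close>

lemma dsub_inst_dren_Suc:
  fixes V :: "'l dvalue" and M :: "'l dcomp"
  shows "dsub_val (case_nat W DVar) (dren_val Suc V) = V"
    and "dsub (case_nat W DVar) (dren Suc M) = M"
proof -
  have "case_nat W DVar \<circ> Suc = DVar"
    by (simp add: fun_eq_iff)
  then show "dsub_val (case_nat W DVar) (dren_val Suc V) = V"
    and "dsub (case_nat W DVar) (dren Suc M) = M"
    by (simp_all add: dsub_dren dsub_DVar)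
qed

lemma dsub_dup_dren_Suc:
  "dsub_val (dup s) (dren_val Suc V) = dren_val Suc (dsub_val s V)"
  "dsub (dup s) (dren Suc M) = dren Suc (dsub s M)"
  by (simp_all add: dsub_dren dren_dsub comp_def)

lemma dren_val_Suc_Suc: "dren_val (\<lambda>n. Suc (Suc n)) V = dren_val Suc (dren_val Suc V)"
  by (simp add: dren_dren comp_def)

text \<open>First administrative substitution: \<open>K\<close> replaces \<open>k\<close> below the
  binders \<open>h\<close> and \<open>y\<close>, hence its two shifts, while \<open>V\<close> loses
  one of its two.\<close>

lemma dsub_op_resumption:
  "dsub1 (DLam (DApp (DForce (DVar 0)) (DInj l (DPair (dren_val (\<lambda>n. n + 2) V)
      (DThunk (DLam (DApp (DApp (DForce (DVar 2)) (DVar 0)) (DVar 1)))))))) K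
   = DLam (DApp (DForce (DVar 0)) (DInj l (DPair (dren_val Suc V)
      (DThunk (DLam (DApp (DApp (DForce (dren_val Suc (dren_val Suc K))) (DVar 0)) (DVar 1)))))))"
  by (simp add: dsub1_def dren_val_Suc_Suc dsub_dup_dren_Suc dsub_inst_dren_Suc numeral_2_eq_2)

text \<open>Second one: \<open>T\<close> replaces \<open>h\<close>, so \<open>K\<close> and
  \<open>T\<close> end up below \<open>y\<close> only.\<close>

lemma dsub_op_clauses_arg:
  "dsub1 (DApp (DForce (DVar 0)) (DInj l (DPair (dren_val Suc V)
      (DThunk (DLam (DApp (DApp (DForce (dren_val Suc (dren_val Suc K))) (DVar 0)) (DVar 1))))))) T
   = DApp (DForce T) (DInj l (DPair V
      (DThunk (DLam (DApp (DApp (DForce (dren_val Suc K)) (DVar 0)) (dren_val Suc T))))))"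
  by (simp add: dsub1_def dsub_dup_dren_Suc dsub_inst_dren_Suc)

text \<open>Serves to contract \<open>(\<lambda>y. M) y\<close> under an outer \<open>y\<close>: the
  renaming skips index \<open>1\<close>, and instantiating index \<open>0\<close> by itself closes
  that gap.\<close>

lemma dsub1_up_ren_Suc:
  fixes M :: "'l dcomp"
  shows "dsub1 (dren (up_ren Suc) M) (DVar 0) = M"
proof -
  have "case_nat (DVar 0) DVar \<circ> up_ren Suc = (DVar :: nat \<Rightarrow> 'l dvalue)"
    by (auto simp: fun_eq_iff up_ren_def split: nat.split)
  then show ?thesis
    by (simp add: dsub1_def dsub_dren dsub_DVar)
qed

section \<open>Simulation of beta steps\<close>

lemma dred_return_clause:
  "dred\<^sup>+\<^sup>+ (DApp (DReset (DReturn V) (DLam (dren Suc N))) T) (dsub1 N V)"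
proof -
  \<comment> \<open>Below \<open>h\<close> the substitution yields its result shifted once; the
    application to \<open>T\<close> then undoes that shift.\<close>
  let ?N = "dren Suc (dsub1 N V)"
  have "dred (DApp (DReset (DReturn V) (DLam (dren Suc N))) T) (DApp (DLam ?N) T)"
    using dbeta.intros(8)[of V "DLam (dren Suc N)"]
    by (auto simp: dsub1_def dsub_dup_dren_Suc intro: dred_val_dred.intros)
  moreover have "dred (DApp (DLam ?N) T) (dsub1 N V)"
    using dbeta.intros(5)[of ?N T]
    by (auto simp: dsub1_def dsub_inst_dren_Suc intro: dred_val_dred.intros)
  ultimately show ?thesis
    by (rule tranclp.trancl_into_trancl[OF tranclp.r_into_trancl])
qed

lemma dred_dispatch:
  assumes "fmlookup H l = Some M"
  shows "dred\<^sup>+\<^sup>+ (DApp (op_clauses H) (DInj l (DPair V W))) (dsub2 M V W)"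
proof -
  let ?U = "DPair V W"
  let ?C = "fmmap (\<lambda>N. DLetPair (DVar 0) (dren (up_ren (up_ren Suc)) N)) H"
  \<comment> \<open>Below \<open>z\<close>, \<open>p\<close> and \<open>k\<close>, eliminating
    \<open>y\<close> reduces the shift by two to a shift past \<open>z\<close> alone.\<close>
  have ren: "dup (dup (dup (case_nat (DInj l ?U) DVar))) \<circ> up_ren (up_ren (\<lambda>n. n + 2))
      = DVar \<circ> up_ren (up_ren Suc)"
    by (auto simp: fun_eq_iff dup_def up_ren_def split: nat.split)
  \<comment> \<open>Eliminating \<open>z\<close> cancels the remaining shift.\<close>
  have ren': "dup (dup (case_nat ?U DVar)) \<circ> up_ren (up_ren Suc) = DVar"
    by (auto simp: fun_eq_iff dup_def up_ren_def split: nat.split)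
  have "dsub1 (DCase (DVar 0) (fmmap (\<lambda>N. DLetPair (DVar 0)
      (dren (up_ren (up_ren (\<lambda>n. n + 2))) N)) H)) (DInj l ?U) = DCase (DInj l ?U) ?C"
    by (auto simp: dsub1_def fmap.map_comp dsub_dren ren[simplified] dsub_DVar_comp
        intro!: fmap.map_cong)
  then have "dbeta (DApp (op_clauses H) (DInj l ?U)) (DCase (DInj l ?U) ?C)"
    unfolding op_clauses_def by (metis dbeta.intros(5))
  moreover have "dbeta (DCase (DInj l ?U) ?C) (DLetPair ?U M)"
  proof -
    have "dsub1 (DLetPair (DVar 0) (dren (up_ren (up_ren Suc)) M)) ?U = DLetPair ?U M"
      using ren' by (simp add: dsub1_def dsub_dren dsub_DVar)
    then show ?thesis
      using dbeta.intros(2)[of ?C l _ ?U] assms by simp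
  qed
  moreover have "dbeta (DLetPair ?U M) (dsub2 M V W)"
    by (rule dbeta.intros)
  ultimately show ?thesis
    by (meson dred_val_dred.intros(1) tranclp.intros)
qed

text \<open>\<open>R\<close> is the body of the captured continuation. Applied to the dispatch
  function it has the shape of a translated handler, so the resumption reinstalls the
  handler.\<close>

lemma dred_op_clause:
  fixes C :: "'l dhoist" and N :: "'l dcomp"
  assumes "fmlookup H l = Some M"
  defines "R \<equiv> DReset (dplug_hoist (dren_hoist Suc C) (DReturn (DVar 0))) (dren (up_ren Suc) N)"
  shows "dred\<^sup>+\<^sup>+
      (DApp (DReset (dplug_hoist C (DShift0 (DLam (DApp (DForce (DVar 0))
        (DInj l (DPair (dren_val (\<lambda>n. n + 2) V)
         (DThunk (DLam (DApp (DApp (DForce (DVar 2)) (DVar 0)) (DVar 1)))))))))) N)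
        (DThunk (op_clauses H)))
      (dsub2 M V (DThunk (DLam (DApp R (dren_val Suc (DThunk (op_clauses H)))))))"
proof -
  let ?T = "DThunk (op_clauses H)"
  \<comment> \<open>The parameter of \<open>?arg\<close> is the subterm that starts as
    \<open>k! y\<close> and becomes \<open>R\<close>.\<close>
  let ?arg = "\<lambda>M. DInj l (DPair V (DThunk (DLam (DApp M (dren_val Suc ?T)))))"
  \<comment> \<open>The continuation at top level, then shifted for use below \<open>y\<close>, then
    for use below both \<open>h\<close> and \<open>y\<close>.\<close>
  let ?k = "DThunk (DLam R)"
  let ?k1 = "dren_val Suc ?k"
  let ?k2 = "dren_val Suc ?k1"
  let ?app = "DLam (DApp (DForce (DVar 0)) (DInj l (DPair (dren_val Suc V)
         (DThunk (DLam (DApp (DApp (DForce ?k2) (DVar 0)) (DVar 1)))))))"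
  have "dred\<^sup>+\<^sup>+ (DApp (DReset (dplug_hoist C (DShift0 (DLam (DApp (DForce (DVar 0))
        (DInj l (DPair (dren_val (\<lambda>n. n + 2) V)
         (DThunk (DLam (DApp (DApp (DForce (DVar 2)) (DVar 0)) (DVar 1)))))))))) N) ?T)
        (DApp ?app ?T)"
    using dbeta.intros(9)[of C _ N, folded R_def]
    by (metis dsub_op_resumption dred_val_dred.intros(1,15) tranclp.r_into_trancl)
  also have "dred\<^sup>+\<^sup>+ (DApp ?app ?T) (DApp (DForce ?T) (?arg (DApp (DForce ?k1) (DVar 0))))"
    by (metis dsub_op_clauses_arg dbeta.intros(5) dred_val_dred.intros(1) tranclp.r_into_trancl)
  also have "dred\<^sup>+\<^sup>+ \<dots> (DApp (op_clauses H) (?arg (DApp (DForce ?k1) (DVar 0))))"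
    by (intro tranclp.r_into_trancl dred_val_dred.intros(15) dred_val_dred.intros(1) dbeta.intros)
  also have "dred\<^sup>+\<^sup>+ \<dots> (DApp (op_clauses H) (?arg (DApp (DLam (dren (up_ren Suc) R)) (DVar 0))))"
  proof -
    have "dred (DForce ?k1) (DLam (dren (up_ren Suc) R))"
      by (simp add: dbeta.intros(3) dred_val_dred.intros(1))
    then show ?thesis
      by (intro tranclp.r_into_trancl dred_val_dred.intros(3-5,14-16))
  qed
  also have "dred\<^sup>+\<^sup>+ \<dots> (DApp (op_clauses H) (?arg R))"
  proof -
    have "dred (DApp (DLam (dren (up_ren Suc) R)) (DVar 0)) R"
      by (metis dsub1_up_ren_Suc dbeta.intros(5) dred_val_dred.intros(1))
    then show ?thesis
      by (intro tranclp.r_into_trancl dred_val_dred.intros(3-5,14-16))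
  qed
  also have "dred\<^sup>+\<^sup>+ \<dots> (dsub2 M V (DThunk (DLam (DApp R (dren_val Suc ?T)))))"
    by (rule dred_dispatch) fact
  finally show ?thesis .
qed

lemma ebeta_simulation:
  assumes "ebeta M N"
  shows "dred\<^sup>+\<^sup>+ (trans_comp M) (trans_comp N)"
  using assms
proof cases
  case (8 V N H)
  then show ?thesis
    by (simp add: trans_sub1 dred_return_clause)
next
  case (9 H l M C V N)
  \<comment> \<open>The source resumption shifts the return clause before the translation adds
    \<open>h\<close>, the target one afterwards; both orders agree.\<close>
  have "Suc \<circ> up_ren Suc = up_ren (up_ren Suc) \<circ> Suc"
    by (simp add: fun_eq_iff)
  moreover have "fmlookup (fmmap trans_comp H) l = Some (trans_comp M)"
    using 9 by simp
  note dred_op_clause[OF this, of "trans_hoist C" "trans_val V" "DLam (dren Suc (trans_comp N))"]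
  ultimately show ?thesis
    using 9 by (simp add: trans_sub2 trans_plug_hoist trans_ren_hoist trans_ren dren_op_clauses
        dren_dren fmap.map_comp comp_def)
qed (auto simp: trans_sub1 trans_sub2 intro!: tranclp.r_into_trancl dred_val_dred.intros(1) intro: dbeta.intros)

section \<open>Closure under evaluation contexts\<close>

lemma tranclp_cong:
  assumes "\<And>x y. r x y \<Longrightarrow> s (f x) (f y)" and "r\<^sup>+\<^sup>+ x y"
  shows "s\<^sup>+\<^sup>+ (f x) (f y)"
  using assms(2) by induction (auto intro: assms(1) tranclp.intros)

lemma dred_frame: "dred M N \<Longrightarrow> dred (dplug_frame B M) (dplug_frame B N)"
  by (cases B) (auto intro: dred_val_dred.intros)

text \<open>The outermost constructor of \<open>K\<close> is the layer next to the hole, so the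
  induction moves that layer into \<open>M\<close> and \<open>N\<close>, which must be
  arbitrary.\<close>

lemma tranclp_dred_trans_plug:
  assumes "dred\<^sup>+\<^sup>+ (trans_comp M) (trans_comp N)"
  shows "dred\<^sup>+\<^sup>+ (trans_comp (eplug K M)) (trans_comp (eplug K N))"
  using assms
proof (induction K arbitrary: M N)
  case (EKFrame K B)
  then show ?case
    using tranclp_cong[of dred dred "dplug_frame (trans_frame B)"]
    by (simp add: trans_plug_frame dred_frame)
next
  case (EKHandle K L H)
  have "dred\<^sup>+\<^sup>+ (trans_comp (EHandle M L H)) (trans_comp (EHandle N L H))"
    unfolding trans_comp.simps
    \<comment> \<open>The handled computation sits inside a reset in function position.\<close>
    by (rule tranclp_cong[OF _ EKHandle.prems]) (intro dred_val_dred.intros(15,22))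
  then show ?case
    by (simp add: EKHandle.IH)
qed simp

theorem theorem6p7:
  fixes M N :: "'l ecomp"
  assumes "estep M N"
  shows "dred\<^sup>+\<^sup>+ (trans_comp M) (trans_comp N)"
  using assms by (auto simp: estep_def intro: tranclp_dred_trans_plug ebeta_simulation)

end
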